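(* Let $C$ and $C'$ be Euler systems of a 4-regular multigraph $F$, and let $P$ be the circuit partition of $F$ described by: (a) at every vertex where $C$ and $C'$ involve the same transition, $P$ involves the same transition; and (b) at every vertex where $C$ and $C'$ involve two different transitions, $P$ involves the third transition. Then, over $GF(2)$, $$\mathcal{I}_{P}(C)=\mathcal{I}_{C'}(C)\cdot\mathcal{I}_{P}(C').$$
   Context: Multigraphs are finite; in a 4-regular multigraph every vertex has degree 4, and loops and parallel edges are allowed (a loop contributes 2 to the degree of its vertex). Each edge consists of two half-edges, so exactly four half-edges are incident at each vertex. A transition at a vertex $v$ is one of the three ways to sort the four half-edges at $v$ into two disjoint pairs. A circuit is a closed walk with no repeated edge; circuits are considered without preferred starting point or orientation. Choosing one transition at each vertex of $F$ yields a partition of the edge set $E(F)$ into edge-disjoint circuits (consecutive half-edges of a circuit passing through a vertex are those paired by the chosen transition); such a partition, together with its transitions, is a circuit partition $P$ of $F$, and $P$ is said to involve the chosen transition at each vertex. An Euler system is a circuit partition containing exactly one circuit (an Euler circuit, containing every edge of the component) for each connected component of $F$. Interlacement: given an Euler system $C$, two vertices $v\neq w$ are interlaced with respect to $C$ if they appear in the order $v\ldots w\ldots v\ldots w$ on one of the circuits of $C$. The interlacement matrix $\mathcal{I}(C)$ is the $V(F)\times V(F)$ zero-diagonal symmetric matrix over $GF(2)$ whose $vw$ entry ($v\neq w$) is $1$ if and only if $v$ and $w$ are interlaced with respect to $C$. Transition labels with respect to $C$: at a vertex $v$, orient the circuit of $C$ incident at $v$ (either way). The transition followed by $C$ at $v$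 is labeled $\phi$; the other transition in which in-directed half-edges are paired with out-directed half-edges is labeled $\chi$; the transition in which the two in-directed half-edges are paired with each other and the two out-directed half-edges are paired with each other is labeled $\psi$. Relative interlacement matrix: for a circuit partition $P$ (for instance an Euler system) and an Euler system $C$ of $F$, $\mathcal{I}_P(C)$ is obtained from $\mathcal{I}(C)$ as follows, all labels being with respect to $C$. If $P$ involves the $\phi$ transition at $v$, change every nonzero entry of the row and column corresponding to $v$ to $0$, and change the diagonal entry of $v$ from $0$ to $1$. If $P$ involves the $\psi$ transition at $v$, change the diagonal entry of $v$ from $0$ to $1$. (No change on account of vertices where $P$ involves the $\chi$ transition.) *)

theory Defs
  imports "Graph_Theory.Graph_Theory" "HOL-Library.Disjoint_Sets" "HOL-Library.Z2"
begin

text \<open>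
  A multigraph is given as a finite bidirected digraph: an edge is a pair \<open>{a, arev a}\<close> of
  mutually reverse arcs. The arc \<open>a\<close> doubles as the half-edge attached at \<open>tail G a\<close>, so the
  half-edges at \<open>v\<close> are \<open>out_arcs G v\<close>, a loop contributes two of them, and the degree of \<open>v\<close>
  is \<open>out_degree G v\<close>. The elements of \<open>sccs\<close> are the connected components.
\<close>

locale four_regular_multigraph = fin_digraph G + bidirected_digraph G arev
  for G :: "('v, 'e) pre_digraph" and arev :: "'e \<Rightarrow> 'e" +
  assumes out_degree_eq_4: "v \<in> verts G \<Longrightarrow> out_degree G v = 4"

definition is_transition :: "('v, 'e) pre_digraph \<Rightarrow> 'v \<Rightarrow> 'e set set \<Rightarrow> bool" where
  "is_transition G v T \<longleftrightarrow> partition_on (out_arcs G v) T \<and> (\<forall>p\<in>T. card p = 2)"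

text \<open>
  A circuit partition is determined by the transition it involves at each vertex, and is
  represented by that choice; its circuits are given by \<open>circuits\<close> below. The values outside
  \<open>verts G\<close> are irrelevant.
\<close>

type_synonym ('v, 'e) circuit_partition = "'v \<Rightarrow> 'e set set"

definition is_circuit_partition :: "('v, 'e) pre_digraph \<Rightarrow> ('v, 'e) circuit_partition \<Rightarrow> bool" where
  "is_circuit_partition G P \<longleftrightarrow> (\<forall>v\<in>verts G. is_transition G v (P v))"

definition closed_trail :: "('v, 'e) pre_digraph \<Rightarrow> ('e \<Rightarrow> 'e) \<Rightarrow> 'e list \<Rightarrow> bool" where
  "closed_trail G arev c \<longleftrightarrow>
     c \<noteq> [] \<and> (\<exists>u. pre_digraph.awalk G u c u) \<and> distinct (map (\<lambda>a. {a, arev a}) c)"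

text \<open>
  A closed trail that arrives at \<open>v\<close> along \<open>a\<close> and leaves along \<open>b\<close> uses the half-edges
  \<open>arev a\<close> and \<open>b\<close> at \<open>v\<close>.
\<close>

definition follows ::
    "('v, 'e) pre_digraph \<Rightarrow> ('e \<Rightarrow> 'e) \<Rightarrow> ('v, 'e) circuit_partition \<Rightarrow> 'e list \<Rightarrow> bool" where
  "follows G arev P c \<longleftrightarrow> closed_trail G arev c \<and>
     (\<forall>i<length c. {arev (c ! i), c ! (Suc i mod length c)} \<in> P (head G (c ! i)))"

text \<open>
  A circuit, without starting point and orientation, is the set of all the closed trails that
  traverse it.
\<close>

definition circuit_of :: "('e \<Rightarrow> 'e) \<Rightarrow> 'e list \<Rightarrow> 'e list set" where
  "circuit_of arev c = range (\<lambda>k. rotate k c) \<union> range (\<lambda>k. rotate k (rev (map arev c)))"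

definition circuits ::
    "('v, 'e) pre_digraph \<Rightarrow> ('e \<Rightarrow> 'e) \<Rightarrow> ('v, 'e) circuit_partition \<Rightarrow> 'e list set set" where
  "circuits G arev P = circuit_of arev ` {c. follows G arev P c}"

text \<open>Both arcs of every edge of the circuit.\<close>

definition circuit_arcs :: "'e list set \<Rightarrow> 'e set" where
  "circuit_arcs \<gamma> = (\<Union>c\<in>\<gamma>. set c)"

definition is_euler_system ::
    "('v, 'e) pre_digraph \<Rightarrow> ('e \<Rightarrow> 'e) \<Rightarrow> ('v, 'e) circuit_partition \<Rightarrow> bool" where
  "is_euler_system G arev C \<longleftrightarrow> is_circuit_partition G C \<and>
     (\<forall>K\<in>pre_digraph.sccs G. \<exists>\<gamma>.
        {\<gamma>' \<in> circuits G arev C. circuit_arcs \<gamma>' \<subseteq> arcs K} = {\<gamma>} \<and> circuit_arcs \<gamma> = arcs K)"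

text \<open>
  In the definitions from here on, the witness \<open>c\<close> ranges over all starting points and
  orientations of a circuit; for an Euler system the choice makes no difference.
\<close>

definition interlaced ::
    "('v, 'e) pre_digraph \<Rightarrow> ('e \<Rightarrow> 'e) \<Rightarrow> ('v, 'e) circuit_partition \<Rightarrow> 'v \<Rightarrow> 'v \<Rightarrow> bool" where
  "interlaced G arev C v w \<longleftrightarrow> v \<noteq> w \<and>
     (\<exists>\<gamma>\<in>circuits G arev C. \<exists>c\<in>\<gamma>. \<exists>i j k l. i < j \<and> j < k \<and> k < l \<and> l < length c \<and>
        tail G (c ! i) = v \<and> tail G (c ! j) = w \<and> tail G (c ! k) = v \<and> tail G (c ! l) = w)"

definition interlacement ::
    "('v, 'e) pre_digraph \<Rightarrow> ('e \<Rightarrow> 'e) \<Rightarrow> ('v, 'e) circuit_partition \<Rightarrow> 'v \<Rightarrow> 'v \<Rightarrow> bit" where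
  "interlacement G arev C v w = (if interlaced G arev C v w then 1 else 0)"

definition out_half_edges :: "('v, 'e) pre_digraph \<Rightarrow> 'e list \<Rightarrow> 'v \<Rightarrow> 'e set" where
  "out_half_edges G c v = {a \<in> set c. tail G a = v}"

definition in_half_edges ::
    "('v, 'e) pre_digraph \<Rightarrow> ('e \<Rightarrow> 'e) \<Rightarrow> 'e list \<Rightarrow> 'v \<Rightarrow> 'e set" where
  "in_half_edges G arev c v = arev ` {a \<in> set c. head G a = v}"

definition label_phi :: "('v, 'e) circuit_partition \<Rightarrow> 'v \<Rightarrow> 'e set set \<Rightarrow> bool" where
  "label_phi C v T \<longleftrightarrow> T = C v"

definition label_psi ::
    "('v, 'e) pre_digraph \<Rightarrow> ('e \<Rightarrow> 'e) \<Rightarrow> ('v, 'e) circuit_partition \<Rightarrow> 'v \<Rightarrow> 'e set set \<Rightarrow> bool" where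
  "label_psi G arev C v T \<longleftrightarrow>
     (\<exists>\<gamma>\<in>circuits G arev C. \<exists>c\<in>\<gamma>. v \<in> tail G ` set c \<and>
        T = {in_half_edges G arev c v, out_half_edges G c v})"

text \<open>
  The remaining transition at \<open>v\<close>, labeled \<open>\<chi>\<close>, leaves the matrix unchanged.
\<close>

definition relative_interlacement ::
    "('v, 'e) pre_digraph \<Rightarrow> ('e \<Rightarrow> 'e) \<Rightarrow> ('v, 'e) circuit_partition \<Rightarrow>
     ('v, 'e) circuit_partition \<Rightarrow> 'v \<Rightarrow> 'v \<Rightarrow> bit" where
  "relative_interlacement G arev P C v w =
     (if v = w then (if label_phi C v (P v) \<or> label_psi G arev C v (P v) then 1 else 0)
      else if label_phi C v (P v) \<or> label_phi C w (P w) then 0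
      else interlacement G arev C v w)"

end

theory Submission
  imports Defs
begin

text \<open>
  The proof works in the cycle space of \<open>F\<close>: functions \<open>x\<close> from half-edges to \<open>GF(2)\<close> that agree
  on the two half-edges of an edge and sum to \<open>0\<close> over the four half-edges at each vertex. If
  \<open>T\<close> is a transition at \<open>u\<close>, then the two pairs of \<open>T\<close> have the same \<open>x\<close>-sum, which is
  written \<open>tval T x\<close>.

  Let \<open>C\<close> be an Euler system and \<open>v\<close> a vertex. The circuit of \<open>C\<close> through \<open>v\<close> is cut by its two
  visits of \<open>v\<close> into two halves. The indicator \<open>x\<close> of the edges of a half lies in the cycle space
  and satisfies \<open>tval (C u) x = \<delta>\<^sub>u\<^sub>v\<close> for all \<open>u\<close>; call any such \<open>x\<close> a vertex half. Its value at a
  transition other than \<open>C u\<close> at a vertex \<open>u \<noteq> v\<close> tells whether \<open>v\<close> and \<open>u\<close> are interlaced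
  (\<open>interlaced_iff_tval\<close>), and at \<open>v\<close> itself it is \<open>1\<close> on the \<open>\<psi>\<close> transition and \<open>0\<close> on the
  \<open>\<chi>\<close> transition (\<open>label_psi_iff_tval\<close>). So the entry of the relative interlacement matrix of \<open>P\<close>
  with respect to \<open>C\<close> at \<open>(v, u)\<close> is \<open>tval (P u) x\<close>, except that row \<open>v\<close> is cleared outside the
  diagonal if \<open>P v = C v\<close> (\<open>relative_interlacement_eq_tval\<close>).

  If \<open>y\<close> is in the cycle space and \<open>tval (C u) y = 0\<close> for all \<open>u\<close>, then \<open>y\<close> is constant along the
  circuits of \<open>C\<close>, hence on the components of \<open>F\<close>, and so \<open>tval T y = 0\<close> for every transition \<open>T\<close>
  (\<open>tval_eq_0I\<close>). Applied to \<open>x\<close> plus the combination of the vertex halves \<open>h w\<close> of \<open>C\<close> with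
  coefficients \<open>tval (C w) x\<close>, this gives the expansion
  \<open>tval T x = (\<Sum>w. tval (C w) x * tval T (h w))\<close> (\<open>tval_expansion\<close>).

  The matrix identity is the expansion for the Euler system \<open>C'\<close>, with \<open>x\<close> a vertex half of \<open>C\<close> at
  \<open>v\<close> and \<open>T = P w\<close>: the rows cleared in the three matrices belong to vertices where \<open>C\<close>, \<open>C'\<close> and
  \<open>P\<close> agree, and clearing them does not disturb the product.
\<close>

section \<open>Closed trails that follow a circuit partition\<close>

context four_regular_multigraph
begin

lemma cas_iff:
  "cas u c w \<longleftrightarrow> (if c = [] then u = w
     else tail G (hd c) = u \<and> head G (last c) = w \<and>
       (\<forall>i. Suc i < length c \<longrightarrow> head G (c ! i) = tail G (c ! Suc i)))"
proof (induction c arbitrary: u)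
  case (Cons a c)
  show ?case
  proof (cases "c = []")
    case False
    then have hd: "hd c = c ! 0" by (simp add: hd_conv_nth)
    have "(\<forall>i. Suc i < length (a # c) \<longrightarrow> head G ((a # c) ! i) = tail G ((a # c) ! Suc i)) \<longleftrightarrow>
        head G a = tail G (hd c) \<and>
        (\<forall>i. Suc i < length c \<longrightarrow> head G (c ! i) = tail G (c ! Suc i))" (is "?L \<longleftrightarrow> ?R")
    proof
      assume L: ?L
      show ?R
      proof (intro conjI allI impI)
        show "head G a = tail G (hd c)" using L[rule_format, of 0] False hd by simp
        show "head G (c ! i) = tail G (c ! Suc i)" if "Suc i < length c" for i
          using L[rule_format, of "Suc i"] that by simp
      qed
    next
      assume R: ?R
      show ?L
      proof (intro allI impI)
        fix i assume "Suc i < length (a # c)"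
        then show "head G ((a # c) ! i) = tail G ((a # c) ! Suc i)"
          using R hd by (cases i) auto
      qed
    qed
    then show ?thesis using Cons False by auto
  qed auto
qed simp

lemma closed_trail_iff:
  "closed_trail G arev c \<longleftrightarrow> c \<noteq> [] \<and> set c \<subseteq> arcs G \<and>
     (\<forall>i<length c. head G (c ! i) = tail G (c ! (Suc i mod length c))) \<and>
     distinct (map (\<lambda>a. {a, arev a}) c)"
proof (cases "c = []")
  case False
  have "(\<forall>i<length c. head G (c ! i) = tail G (c ! (Suc i mod length c))) \<longleftrightarrow>
      head G (last c) = tail G (hd c) \<and>
      (\<forall>i. Suc i < length c \<longrightarrow> head G (c ! i) = tail G (c ! Suc i))" (is "?L \<longleftrightarrow> ?R")
  proof
    assume L: ?L
    show ?R
    proof (intro conjI allI impI)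
      show "head G (last c) = tail G (hd c)"
        using L[rule_format, of "length c - 1"] False by (simp add: last_conv_nth hd_conv_nth)
      show "head G (c ! i) = tail G (c ! Suc i)" if "Suc i < length c" for i
        using L[rule_format, of i] that by simp
    qed
  next
    assume R: ?R
    show ?L
    proof (intro allI impI)
      fix i assume i: "i < length c"
      show "head G (c ! i) = tail G (c ! (Suc i mod length c))"
      proof (cases "Suc i = length c")
        case True
        then have "i = length c - 1" by simp
        then show ?thesis using R False by (simp add: last_conv_nth hd_conv_nth)
      next
        case False
        then show ?thesis using R i by simp
      qed
    qed
  qed
  moreover have "hd c \<in> arcs G \<Longrightarrow> tail G (hd c) \<in> verts G" by simp
  ultimately show ?thesis
    using False unfolding closed_trail_def awalk_def cas_iff
    by (auto simp: subset_iff)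
qed (simp add: closed_trail_def)

lemma followsD:
  assumes "follows G arev C c"
  shows "c \<noteq> []" "set c \<subseteq> arcs G"
    "\<And>i. i < length c \<Longrightarrow> head G (c ! i) = tail G (c ! (Suc i mod length c))"
    "\<And>i. i < length c \<Longrightarrow>
      {arev (c ! i), c ! (Suc i mod length c)} \<in> C (tail G (c ! (Suc i mod length c)))"
  using assms unfolding follows_def closed_trail_iff by auto

lemma follows_distinct:
  assumes "follows G arev C c" "i < length c" "j < length c"
  shows "c ! i = c ! j \<longleftrightarrow> i = j" "arev (c ! i) \<noteq> c ! j"
proof -
  have d: "distinct (map (\<lambda>a. {a, arev a}) c)"
    using assms(1) unfolding follows_def closed_trail_def by blast
  have eq: "{c ! i, arev (c ! i)} = {c ! j, arev (c ! j)} \<longleftrightarrow> i = j"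
    using nth_eq_iff_index_eq[OF d, of i j] assms(2,3) by simp
  then show "c ! i = c ! j \<longleftrightarrow> i = j" by auto
  have "c ! i \<in> arcs G" using followsD(2)[OF assms(1)] assms(2) by auto
  then have "arev (c ! i) \<noteq> c ! i" by (rule arev_neq)
  then show "arev (c ! i) \<noteq> c ! j" using eq by (metis arev_arev insert_commute)
qed

text \<open>Positions on a closed trail are cyclic; \<open>m\<close> is the position before \<open>j\<close>.\<close>

lemma follows_pred:
  assumes "follows G arev C c" "j < length c"
  obtains m where "m < length c" "Suc m mod length c = j"
proof (cases j)
  case 0
  then show thesis using that[of "length c - 1"] assms(2) by simp
next
  case (Suc m)
  then show thesis using that[of m] assms(2) by simp
qed

lemma follows_rotate1:
  assumes "follows G arev C c"
  shows "follows G arev C (rotate1 c)"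
proof -
  let ?n = "length c"
  have n: "?n > 0" using followsD(1)[OF assms] by simp
  have r: "rotate1 c ! i = c ! (Suc i mod ?n)" if "i < ?n" for i
    using that nth_rotate[of i c 1] by simp
  have "distinct (map (\<lambda>a. {a, arev a}) (rotate1 c))"
    using assms unfolding follows_def closed_trail_def by (simp flip: rotate1_map)
  then show ?thesis
    using assms n unfolding follows_def closed_trail_iff by (auto simp: r)
qed

lemma follows_rotate: "follows G arev C c \<Longrightarrow> follows G arev C (rotate k c)"
  by (induction k) (auto intro: follows_rotate1)

lemma follows_rev:
  assumes "follows G arev C c"
  shows "follows G arev C (rev (map arev c))"
proof -
  let ?n = "length c" and ?d = "rev (map arev c)"
  have n: "?n > 0" using followsD(1)[OF assms] by simp
  have d: "?d ! i = arev (c ! (?n - Suc i))" if "i < ?n" for i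
    using that by (simp add: rev_nth)
  have arc: "c ! i \<in> arcs G" if "i < ?n" for i
    using followsD(2)[OF assms] that by auto
  \<comment> \<open>Two consecutive arcs of the reversed trail are the reverses of the arcs at \<open>m\<close>
    and \<open>m + 1\<close>, in the opposite order.\<close>
  have step: "\<exists>m<?n. ?d ! i = arev (c ! (Suc m mod ?n)) \<and> ?d ! (Suc i mod ?n) = arev (c ! m)"
    if "i < ?n" for i
  proof (cases "Suc i = ?n")
    case True
    then show ?thesis using that n by (intro exI[of _ "?n - 1"]) (simp add: d)
  next
    case False
    then have "Suc (?n - Suc (Suc i)) = ?n - Suc i" using that by simp
    then show ?thesis using that n False
      by (intro exI[of _ "?n - Suc (Suc i)"]) (simp add: d)
  qed
  have "distinct (map (\<lambda>a. {a, arev a}) ?d)"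
    using assms unfolding follows_def closed_trail_def
    by (simp add: rev_map[symmetric] o_def insert_commute)
  moreover have step': "head G (?d ! i) = tail G (?d ! (Suc i mod ?n)) \<and>
      {arev (?d ! i), ?d ! (Suc i mod ?n)} \<in> C (head G (?d ! i))" if i: "i < ?n" for i
  proof -
    obtain m where m: "m < ?n" "?d ! i = arev (c ! (Suc m mod ?n))"
      "?d ! (Suc i mod ?n) = arev (c ! m)" using step[OF i] by blast
    have "Suc m mod ?n < ?n" using n by simp
    then show ?thesis
      using followsD(3,4)[OF assms m(1)] arc m by (simp add: insert_commute)
  qed
  moreover have "set ?d \<subseteq> arcs G" using followsD(2)[OF assms] by auto
  moreover have "?d \<noteq> []" using n by simp
  ultimately show ?thesis
    using step' unfolding follows_def closed_trail_iff length_rev length_map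
    by (intro conjI allI impI) (assumption | rule step'[THEN conjunct1] step'[THEN conjunct2])+
qed

section \<open>The circuits of an Euler system\<close>

text \<open>
  A closed trail following \<open>C\<close> that uses all edges at the vertices it visits, that is, all edges of
  its component. Every representative of every circuit of an Euler system is of this kind, so the
  components of the graph play no role after this section.
\<close>

definition covering_trail :: "('v, 'e) circuit_partition \<Rightarrow> 'e list \<Rightarrow> bool" where
  "covering_trail C c \<longleftrightarrow> follows G arev C c \<and>
     (\<forall>v\<in>tail G ` set c. out_arcs G v \<subseteq> set c \<union> arev ` set c)"

lemma component_exists:
  assumes "v \<in> verts G"
  obtains K where "K \<in> sccs" "v \<in> verts K"
    "\<And>a. a \<in> arcs K \<longleftrightarrow> a \<in> arcs G \<and> tail G a \<in> verts K"
    "\<And>a. a \<in> arcs G \<Longrightarrow> tail G a \<in> verts K \<Longrightarrow> head G a \<in> verts K"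
proof -
  let ?K = "induce_subgraph G {w. v \<rightarrow>\<^sup>*\<^bsub>G\<^esub> w}"
  have hd: "v \<rightarrow>\<^sup>*\<^bsub>G\<^esub> head G a" if "a \<in> arcs G" "v \<rightarrow>\<^sup>*\<^bsub>G\<^esub> tail G a" for a
    using that by (meson in_arcs_imp_in_arcs_ends reachable_adj_trans)
  show thesis
  proof (rule that[of ?K])
    show "?K \<in> sccs" by (rule induce_reachable_is_in_sccs[OF assms])
  qed (use assms hd in auto)
qed

lemma follows_subset_component:
  assumes f: "follows G arev C c"
    and hK: "\<And>a. a \<in> arcs G \<Longrightarrow> tail G a \<in> verts K \<Longrightarrow> head G a \<in> verts K"
    and "tail G (c ! 0) \<in> verts K"
  shows "tail G ` set c \<subseteq> verts K"
proof -
  have "i < length c \<Longrightarrow> tail G (c ! i) \<in> verts K" for i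
  proof (induction i)
    case (Suc i)
    then have "tail G (c ! Suc i) = head G (c ! i)" using followsD(3)[OF f, of i] by simp
    moreover have "c ! i \<in> arcs G" using followsD(2)[OF f] Suc by auto
    ultimately show ?case using Suc hK by simp
  qed (use assms in simp)
  then show ?thesis by (auto simp: in_set_conv_nth)
qed

lemma circuit_arcs_circuit_of: "circuit_arcs (circuit_of arev c) = set c \<union> arev ` set c"
  by (auto simp: circuit_arcs_def circuit_of_def)

lemma circuit_of_self: "c \<in> circuit_of arev c"
  by (auto simp: circuit_of_def intro: range_eqI[of _ _ 0])

lemma euler_system_follows:
  assumes C: "is_euler_system G arev C" and f: "follows G arev C c"
  shows "covering_trail C c"
  unfolding covering_trail_def
proof (intro conjI f ballI)
  fix v assume v: "v \<in> tail G ` set c"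
  let ?u = "tail G (c ! 0)"
  have c: "c \<noteq> []" "set c \<subseteq> arcs G" using followsD[OF f] by auto
  then have "c ! 0 \<in> arcs G" by auto
  then have "?u \<in> verts G" by simp
  then obtain K where K: "K \<in> sccs" "?u \<in> verts K"
    and aK: "\<And>a. a \<in> arcs K \<longleftrightarrow> a \<in> arcs G \<and> tail G a \<in> verts K"
    and hK: "\<And>a. a \<in> arcs G \<Longrightarrow> tail G a \<in> verts K \<Longrightarrow> head G a \<in> verts K"
    by (metis component_exists)
  have sub: "tail G ` set c \<subseteq> verts K" by (rule follows_subset_component[OF f hK K(2)])
  have arcs: "set c \<union> arev ` set c \<subseteq> arcs K"
  proof -
    have "arev a \<in> arcs K" if "a \<in> set c" for a
    proof -
      have "a \<in> arcs G" "tail G a \<in> verts K" using that c(2) sub by auto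
      then show ?thesis using hK[of a] aK[of "arev a"] by simp
    qed
    then show ?thesis using c sub aK by auto
  qed
  obtain \<gamma> where \<gamma>: "{\<gamma>' \<in> circuits G arev C. circuit_arcs \<gamma>' \<subseteq> arcs K} = {\<gamma>}"
    "circuit_arcs \<gamma> = arcs K" using C K(1) unfolding is_euler_system_def by metis
  have "circuit_of arev c \<in> circuits G arev C" using f unfolding circuits_def by simp
  then have "circuit_of arev c \<in> {\<gamma>' \<in> circuits G arev C. circuit_arcs \<gamma>' \<subseteq> arcs K}"
    using arcs by (simp add: circuit_arcs_circuit_of)
  then have "circuit_of arev c = \<gamma>" unfolding \<gamma>(1) by (rule singletonD)
  then have "set c \<union> arev ` set c = arcs K" using \<gamma> by (simp flip: circuit_arcs_circuit_of)
  then show "out_arcs G v \<subseteq> set c \<union> arev ` set c"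
    using v sub aK by auto
qed

lemma euler_system_circuits:
  assumes C: "is_euler_system G arev C" and "\<gamma> \<in> circuits G arev C" "c \<in> \<gamma>"
  shows "covering_trail C c"
proof (rule euler_system_follows[OF C])
  obtain d where "follows G arev C d" "c \<in> circuit_of arev d"
    using assms unfolding circuits_def by auto
  then show "follows G arev C c"
    unfolding circuit_of_def using follows_rev follows_rotate by auto
qed

lemma covering_trail_exists:
  assumes C: "is_euler_system G arev C" and v: "v \<in> verts G"
  obtains c where "covering_trail C c" "v \<in> tail G ` set c"
proof -
  obtain K where K: "K \<in> sccs" "v \<in> verts K"
    and aK: "\<And>a. a \<in> arcs K \<longleftrightarrow> a \<in> arcs G \<and> tail G a \<in> verts K"
    using component_exists[OF v] by metis
  obtain \<gamma> where \<gamma>: "{\<gamma>' \<in> circuits G arev C. circuit_arcs \<gamma>' \<subseteq> arcs K} = {\<gamma>}"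
    "circuit_arcs \<gamma> = arcs K" using C K(1) unfolding is_euler_system_def by metis
  then have "\<gamma> \<in> circuits G arev C" by blast
  then obtain c where c: "follows G arev C c" "\<gamma> = circuit_of arev c"
    unfolding circuits_def by auto
  then have arcs: "set c \<union> arev ` set c = arcs K" using \<gamma> by (simp add: circuit_arcs_circuit_of)
  have "card (out_arcs G v) = 4" using out_degree_eq_4[OF v] by (simp add: out_degree_def)
  then have "out_arcs G v \<noteq> {}" by force
  then obtain a where a: "a \<in> out_arcs G v" by blast
  then have "a \<in> arcs K" using aK K by auto
  then have "v \<in> tail G ` set c"
  proof (cases "a \<in> set c")
    case False
    then obtain b where b: "b \<in> set c" "a = arev b" using \<open>a \<in> arcs K\<close> arcs by auto
    then obtain m where m: "m < length c" "c ! m = b" by (auto simp: in_set_conv_nth)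
    have "b \<in> arcs G" using followsD(2)[OF c(1)] b by auto
    then have "v = head G b" using a b by auto
    then have "v = tail G (c ! (Suc m mod length c))" using followsD(3)[OF c(1) m(1)] m by simp
    moreover have "Suc m mod length c < length c" using m(1) by (intro mod_less_divisor) linarith
    ultimately show ?thesis by auto
  qed (use a in auto)
  then show thesis using that euler_system_follows[OF C c(1)] by blast
qed

section \<open>Transitions and the cycle space\<close>

lemma bit_add_eq_0_iff: "a + b = 0 \<longleftrightarrow> a = b" for a b :: bit
  by (cases a; cases b) auto

lemma sum_four:
  fixes x :: "'a \<Rightarrow> 'b::comm_monoid_add"
  shows "distinct [a, b, d, e] \<Longrightarrow> sum x {a, b, d, e} = (x a + x b) + (x d + x e)"
  by (simp add: add.assoc)

lemma transition_elems:
  assumes "is_transition G v T" "v \<in> verts G"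
  obtains a b d e where "distinct [a, b, d, e]" "T = {{a, b}, {d, e}}" "out_arcs G v = {a, b, d, e}"
proof -
  have p: "partition_on (out_arcs G v) T" and two: "\<And>p. p \<in> T \<Longrightarrow> card p = 2"
    using assms by (auto simp: is_transition_def)
  have "card (out_arcs G v) = 4"
    using out_degree_eq_4[OF assms(2)] by (simp add: out_degree_def)
  moreover have U: "\<Union>T = out_arcs G v" and dis: "disjoint T"
    using p by (auto simp: partition_on_def)
  moreover have "card (\<Union>T) = (\<Sum>p\<in>T. card p)"
  proof (rule card_Union_disjoint)
    show "pairwise disjnt T" using dis by (simp add: disjoint_def pairwise_def disjnt_def)
    show "finite p" if "p \<in> T" for p using two[OF that] by (metis card.infinite zero_neq_numeral)
  qed
  ultimately have "card T = 2" using two by simp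
  then obtain p q where pq: "T = {p, q}" "p \<noteq> q" by (auto simp: card_2_iff)
  moreover obtain a b where "p = {a, b}" "a \<noteq> b" using two[of p] pq by (auto simp: card_2_iff)
  moreover obtain d e where "q = {d, e}" "d \<noteq> e" using two[of q] pq by (auto simp: card_2_iff)
  moreover have "p \<inter> q = {}" using dis pq by (auto simp: disjoint_def)
  ultimately show thesis using U by (intro that[of a b d e]) auto
qed

lemma transition_cases:
  assumes "is_transition G v T" "v \<in> verts G"
    and "distinct [a, b, d, e]" "out_arcs G v = {a, b, d, e}"
  shows "T = {{a, b}, {d, e}} \<or> T = {{a, d}, {b, e}} \<or> T = {{a, e}, {b, d}}"
proof -
  have U: "\<Union>T = {a, b, d, e}" and two: "\<And>p. p \<in> T \<Longrightarrow> card p = 2"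
    using assms by (auto simp: is_transition_def partition_on_def)
  then obtain p where p: "p \<in> T" "a \<in> p" by blast
  then obtain y where y: "p = {a, y}" "a \<noteq> y"
    using two[of p] by (auto simp: card_2_iff doubleton_eq_iff)
  then have "y \<in> {a, b, d, e}" using p(1) by (subst U[symmetric]) blast
  then have ybde: "y = b \<or> y = d \<or> y = e" using y(2) by simp
  obtain a' b' d' e' where *: "distinct [a', b', d', e']" "T = {{a', b'}, {d', e'}}"
    "out_arcs G v = {a', b', d', e'}" by (rule transition_elems[OF assms(1,2)])
  have "T = {p, out_arcs G v - p}"
  proof (cases "p = {a', b'}")
    case True
    then have "out_arcs G v - p = {d', e'}" using * by auto
    then show ?thesis using True *(2) by simp
  next
    case False
    then have p': "p = {d', e'}" using p(1) *(2) by simp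
    then have "out_arcs G v - p = {a', b'}" using * by auto
    then show ?thesis using p' *(2) by (simp add: insert_commute)
  qed
  then have T: "T = {{a, y}, {a, b, d, e} - {a, y}}" using y assms(4) by simp
  from ybde show ?thesis
  proof (elim disjE)
    assume "y = b"
    then have "{a, b, d, e} - {a, y} = {d, e}" using assms(3) by auto
    then show ?thesis using T \<open>y = b\<close> by simp
  next
    assume "y = d"
    then have "{a, b, d, e} - {a, y} = {b, e}" using assms(3) by auto
    then show ?thesis using T \<open>y = d\<close> by simp
  next
    assume "y = e"
    then have "{a, b, d, e} - {a, y} = {b, d}" using assms(3) by auto
    then show ?thesis using T \<open>y = e\<close> by simp
  qed
qed

text \<open>
  Elements of the cycle space over \<open>GF(2)\<close>, as functions on half-edges. Values on arcs outside the
  graph are unconstrained.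
\<close>

definition cycle_vector :: "('e \<Rightarrow> bit) \<Rightarrow> bool" where
  "cycle_vector x \<longleftrightarrow> (\<forall>a\<in>arcs G. x (arev a) = x a) \<and> (\<forall>v\<in>verts G. (\<Sum>a\<in>out_arcs G v. x a) = 0)"

text \<open>
  The sum of \<open>x\<close> over one of the two pairs of \<open>T\<close>; by \<open>tval_pair\<close> the choice is irrelevant if \<open>x\<close>
  is a cycle vector. Fixing one pair for all \<open>x\<close> makes \<open>tval T\<close> linear by definition.
\<close>

definition tval :: "'e set set \<Rightarrow> ('e \<Rightarrow> bit) \<Rightarrow> bit" where
  "tval T x = (\<Sum>a\<in>(SOME p. p \<in> T). x a)"

lemma tval_pair:
  assumes "is_transition G v T" "v \<in> verts G" "(\<Sum>a\<in>out_arcs G v. x a) = 0" "p \<in> T"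
  shows "tval T x = (\<Sum>a\<in>p. x a)"
proof -
  obtain a b d e where T: "distinct [a, b, d, e]" "T = {{a, b}, {d, e}}"
    "out_arcs G v = {a, b, d, e}" by (rule transition_elems[OF assms(1,2)])
  then have eq: "x a + x b = x d + x e"
    using assms(3) unfolding T(3) sum_four[OF T(1)] bit_add_eq_0_iff by simp
  have "sum x q = x a + x b" if "q \<in> T" for q
  proof -
    have "q = {a, b} \<or> q = {d, e}" using that T(2) by simp
    then show ?thesis using T(1) eq by (elim disjE) simp_all
  qed
  moreover have "(SOME p. p \<in> T) \<in> T" using assms(4) by (rule someI)
  ultimately show ?thesis using assms(4) by (simp only: tval_def)
qed

lemma transition_const_pair_sums:
  assumes "is_transition G v T" "v \<in> verts G" "\<And>p. p \<in> T \<Longrightarrow> (\<Sum>a\<in>p. x a) = b"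
  shows "tval T x = b" "(\<Sum>a\<in>out_arcs G v. x a) = 0"
proof -
  obtain a b' d e where T: "distinct [a, b', d, e]" "T = {{a, b'}, {d, e}}"
    "out_arcs G v = {a, b', d, e}" by (rule transition_elems[OF assms(1,2)])
  have "sum x {a, b'} = b" "sum x {d, e} = b" using assms(3) T(2) by blast+
  then have "x a + x b' = x d + x e" using T(1) by simp
  then show "(\<Sum>a\<in>out_arcs G v. x a) = 0"
    unfolding T(3) sum_four[OF T(1)] bit_add_eq_0_iff .
  have "(SOME p. p \<in> T) \<in> T" by (rule someI[where x = "{a, b'}"]) (simp add: T(2))
  then show "tval T x = b" unfolding tval_def using assms(3) by blast
qed

lemma tval_linear:
  "tval T (\<lambda>a. x a + (\<Sum>w\<in>W. f w * y w a)) = tval T x + (\<Sum>w\<in>W. f w * tval T (y w))"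
  unfolding tval_def sum.distrib sum_distrib_left by (subst sum.swap) (rule refl)

lemma cycle_vector_linear:
  assumes "cycle_vector x" "\<And>w. w \<in> W \<Longrightarrow> cycle_vector (y w)"
  shows "cycle_vector (\<lambda>a. x a + (\<Sum>w\<in>W. f w * y w a))"
  unfolding cycle_vector_def
proof (intro conjI ballI)
  show "x (arev a) + (\<Sum>w\<in>W. f w * y w (arev a)) = x a + (\<Sum>w\<in>W. f w * y w a)"
    if "a \<in> arcs G" for a
    using assms that unfolding cycle_vector_def by simp
next
  fix v assume v: "v \<in> verts G"
  have "(\<Sum>a\<in>out_arcs G v. \<Sum>w\<in>W. f w * y w a) = (\<Sum>w\<in>W. f w * (\<Sum>a\<in>out_arcs G v. y w a))"
    unfolding sum_distrib_left by (rule sum.swap)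
  also have "\<dots> = 0" using assms(2) v unfolding cycle_vector_def by simp
  finally show "(\<Sum>a\<in>out_arcs G v. x a + (\<Sum>w\<in>W. f w * y w a)) = 0"
    using assms(1) v unfolding cycle_vector_def sum.distrib by simp
qed

section \<open>Cutting a circuit at a vertex\<close>

text \<open>Every pair of half-edges in \<open>C v\<close> is used by a passage of the trail through \<open>v\<close>.\<close>

lemma covering_trail_pair:
  assumes c: "covering_trail C c" and C: "is_circuit_partition G C"
    and v: "v \<in> tail G ` set c" and p: "p \<in> C v"
  obtains m where "m < length c" "tail G (c ! (Suc m mod length c)) = v"
    "p = {arev (c ! m), c ! (Suc m mod length c)}"
proof -
  have f: "follows G arev C c" using c by (simp add: covering_trail_def)
  note fD = followsD[OF f]
  have "v \<in> verts G" using v fD(2) by auto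
  then have T: "is_transition G v (C v)" using C by (simp add: is_circuit_partition_def)
  then have "p \<subseteq> out_arcs G v" "p \<noteq> {}"
    using p unfolding is_transition_def partition_on_def by auto
  then obtain a where a: "a \<in> p" "a \<in> out_arcs G v" by blast
  then have "a \<in> set c \<union> arev ` set c" using c v unfolding covering_trail_def by blast
  then obtain m where m: "m < length c" "a \<in> {arev (c ! m), c ! (Suc m mod length c)}"
  proof
    assume "a \<in> set c"
    then obtain j where j: "j < length c" "a = c ! j" by (metis in_set_conv_nth)
    obtain m where "m < length c" "Suc m mod length c = j" by (rule follows_pred[OF f j(1)])
    then show thesis using that[of m] j(2) by simp
  next
    assume "a \<in> arev ` set c"
    then obtain b where b: "b \<in> set c" "a = arev b" by blast
    then obtain m where "m < length c" "b = c ! m" by (metis in_set_conv_nth)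
    then show thesis using that[of m] b(2) by simp
  qed
  have "Suc m mod length c < length c" using m(1) by (intro mod_less_divisor) linarith
  then have arcs: "c ! m \<in> arcs G" "c ! (Suc m mod length c) \<in> arcs G"
    using fD(2) m(1) by (meson nth_mem subsetD)+
  have "tail G a = v" using a(2) by simp
  moreover have "tail G (arev (c ! m)) = tail G (c ! (Suc m mod length c))"
    using fD(3)[OF m(1)] arcs(1) by simp
  ultimately have tl: "tail G (c ! (Suc m mod length c)) = v" using m(2) by (elim insertE) auto
  let ?q = "{arev (c ! m), c ! (Suc m mod length c)}"
  have "?q \<in> C v" using fD(4)[OF m(1)] unfolding tl .
  moreover have "p \<inter> ?q \<noteq> {}" using a(1) m(2) by blast
  moreover have "disjoint (C v)" using T by (simp add: is_transition_def partition_on_def)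
  ultimately have "p = ?q" using p by (metis disjointD)
  with m(1) tl show thesis by (rule that)
qed

lemma covering_trail_two_visits:
  assumes c: "covering_trail C c" and C: "is_circuit_partition G C" and v: "v \<in> tail G ` set c"
  obtains i k where "i < k" "k < length c"
    "\<And>j. j < length c \<Longrightarrow> tail G (c ! j) = v \<longleftrightarrow> j = i \<or> j = k"
proof -
  have f: "follows G arev C c" using c by (simp add: covering_trail_def)
  note fD = followsD[OF f]
  have vG: "v \<in> verts G" using v fD(2) by auto
  then have T: "is_transition G v (C v)" using C by (simp add: is_circuit_partition_def)
  obtain a b d e where abde: "distinct [a, b, d, e]" "C v = {{a, b}, {d, e}}"
    "out_arcs G v = {a, b, d, e}" by (rule transition_elems[OF T vG])
  obtain m where m: "m < length c" "tail G (c ! (Suc m mod length c)) = v"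
    "{a, b} = {arev (c ! m), c ! (Suc m mod length c)}"
    by (rule covering_trail_pair[OF c C v, of "{a, b}"]) (simp add: abde(2))
  obtain l where l: "l < length c" "tail G (c ! (Suc l mod length c)) = v"
    "{d, e} = {arev (c ! l), c ! (Suc l mod length c)}"
    by (rule covering_trail_pair[OF c C v, of "{d, e}"]) (simp add: abde(2))
  let ?i = "Suc m mod length c" and ?k = "Suc l mod length c"
  have "length c > 0" using m(1) by linarith
  then have lt: "?i < length c" "?k < length c" by simp_all
  have ne: "?i \<noteq> ?k"
  proof
    assume "?i = ?k"
    moreover have "c ! ?i \<in> {a, b}" "c ! ?k \<in> {d, e}" unfolding m(3) l(3) by simp_all
    ultimately show False using abde(1) by auto
  qed
  have all: "tail G (c ! j) = v \<longleftrightarrow> j = ?i \<or> j = ?k" if j: "j < length c" for j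
  proof
    assume tj: "tail G (c ! j) = v"
    obtain s where s: "s < length c" "Suc s mod length c = j" by (rule follows_pred[OF f j])
    have "{arev (c ! s), c ! j} \<in> C v" using fD(4)[OF s(1)] unfolding s(2) tj .
    then have "c ! j \<in> {a, b} \<or> c ! j \<in> {d, e}" unfolding abde(2) by blast
    then have "c ! j = c ! ?i \<or> c ! j = c ! ?k"
      unfolding m(3) l(3)
      using follows_distinct(2)[OF f m(1) j] follows_distinct(2)[OF f l(1) j]
      by (metis insertE singletonD)
    then show "j = ?i \<or> j = ?k"
      using follows_distinct(1)[OF f j] lt by blast
  next
    assume "j = ?i \<or> j = ?k"
    then show "tail G (c ! j) = v" using m(2) l(2) by (elim disjE) (simp_all only:)
  qed
  from ne consider "?i < ?k" | "?k < ?i" by linarith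
  then show thesis
  proof cases
    case 1
    then show thesis using lt(2) all by (rule that)
  next
    case 2
    then show thesis using lt(1) by (rule that) (simp only: all disj_commute)
  qed
qed

text \<open>The indicator of the edges at the positions \<open>i, \<dots>, k - 1\<close> of the trail \<open>c\<close>.\<close>

definition segment_vector :: "'e list \<Rightarrow> nat \<Rightarrow> nat \<Rightarrow> 'e \<Rightarrow> bit" where
  "segment_vector c i k a = (if \<exists>m\<in>{i..<k}. a = c ! m \<or> a = arev (c ! m) then 1 else 0)"

lemma segment_vector_arev: "segment_vector c i k (arev a) = segment_vector c i k a"
proof -
  have "arev a = b \<longleftrightarrow> a = arev b" for b by (metis arev_arev)
  then show ?thesis unfolding segment_vector_def by (simp add: disj_commute)
qed

lemma segment_vector_nth:
  assumes "follows G arev C c" "k < length c" "m < length c"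
  shows "segment_vector c i k (c ! m) = (if i \<le> m \<and> m < k then 1 else 0)"
proof -
  have "c ! m = c ! l \<or> c ! m = arev (c ! l) \<longleftrightarrow> m = l" if "l < k" for l
  proof -
    have "l < length c" using assms(2) that by simp
    then have "c ! m = c ! l \<longleftrightarrow> m = l" "arev (c ! l) \<noteq> c ! m"
      using follows_distinct[OF assms(1)] assms(3) by blast+
    then show ?thesis by metis
  qed
  then show ?thesis unfolding segment_vector_def by auto
qed

lemma segment_vector_outside:
  assumes f: "follows G arev C c" and k: "k < length c"
    and u: "u \<notin> tail G ` set c" "a \<in> out_arcs G u"
  shows "segment_vector c i k a = 0"
proof (rule ccontr)
  note fD = followsD[OF f]
  assume "segment_vector c i k a \<noteq> 0"
  then have "\<exists>m\<in>{i..<k}. a = c ! m \<or> a = arev (c ! m)"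
    unfolding segment_vector_def by meson
  then obtain m where m: "m < length c" "a = c ! m \<or> a = arev (c ! m)"
    using k by (meson atLeastLessThan_iff less_trans)
  have "c ! m \<in> arcs G" "Suc m mod length c < length c"
    using fD(2) m(1) by (auto intro: mod_less_divisor)
  then have "u = tail G (c ! m) \<or> u = tail G (c ! (Suc m mod length c))"
    using u(2) m(2) fD(3)[OF m(1)] by auto
  then show False using u(1) m(1) \<open>Suc m mod length c < length c\<close> by auto
qed

text \<open>
  Cycle vectors that look to \<open>C\<close> like half of its circuit through \<open>v\<close>, cut at \<open>v\<close>. There are
  several (the other half, or a sum with whole components), but all have the same values at
  transitions, see \<open>vertex_half_tval_unique\<close>.
\<close>

definition vertex_half :: "('v, 'e) circuit_partition \<Rightarrow> 'v \<Rightarrow> ('e \<Rightarrow> bit) \<Rightarrow> bool" where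
  "vertex_half C v x \<longleftrightarrow>
     cycle_vector x \<and> (\<forall>u\<in>verts G. tval (C u) x = (if u = v then 1 else 0))"

text \<open>
  The value of the segment changes along the trail only on entering position \<open>i\<close> or \<open>k\<close>, and these
  are the two visits of \<open>v\<close>.
\<close>

lemma segment_vertex_half:
  assumes c: "covering_trail C c" and C: "is_circuit_partition G C"
    and i: "i < k" "k < length c" "tail G (c ! i) = v" "tail G (c ! k) = v"
  shows "vertex_half C v (segment_vector c i k)"
proof -
  let ?x = "segment_vector c i k" and ?n = "length c"
  have f: "follows G arev C c" using c by (simp add: covering_trail_def)
  note fD = followsD[OF f]
  have two: "tail G (c ! j) = v \<longleftrightarrow> j = i \<or> j = k" if j: "j < ?n" for j
  proof -
    have "v \<in> tail G ` set c" using i by auto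
    then obtain i' k' where
      *: "i' < k'" "k' < ?n" "\<And>j. j < ?n \<Longrightarrow> tail G (c ! j) = v \<longleftrightarrow> j = i' \<or> j = k'"
      by (rule covering_trail_two_visits[OF c C]) blast
    then have "i' = i" "k' = k" using i *(3)[of i] *(3)[of k] by auto
    then show ?thesis using *(3)[OF j] by simp
  qed
  have *: "(\<Sum>a\<in>p. ?x a) = (if u = v then 1 else 0)" if u: "u \<in> verts G" and p: "p \<in> C u" for u p
  proof (cases "u \<in> tail G ` set c")
    case True
    then obtain m where m: "m < ?n" "tail G (c ! (Suc m mod ?n)) = u"
      "p = {arev (c ! m), c ! (Suc m mod ?n)}" using covering_trail_pair[OF c C _ p] by blast
    let ?j = "Suc m mod ?n"
    have j: "?j < ?n" using m(1) by (intro mod_less_divisor) auto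
    have "(\<Sum>a\<in>p. ?x a) = ?x (c ! m) + ?x (c ! ?j)"
      using m(3) follows_distinct(2)[OF f m(1) j] by (simp add: segment_vector_arev)
    also have "\<dots> = (if ?j = i \<or> ?j = k then 1 else 0)"
      using i m(1) j unfolding segment_vector_nth[OF f i(2) m(1)] segment_vector_nth[OF f i(2) j]
      by (cases "Suc m = ?n") auto
    finally show ?thesis using two[OF j] m(2) by auto
  next
    case False
    have "?x a = 0" if "a \<in> out_arcs G u" for a
      by (rule segment_vector_outside[OF f i(2) False that])
    moreover have "p \<subseteq> out_arcs G u" using C u p
      unfolding is_circuit_partition_def is_transition_def partition_on_def by blast
    moreover have "u \<noteq> v" using False i by auto
    ultimately show ?thesis by (simp add: subset_iff)
  qed
  have vals: "tval (C u) ?x = (if u = v then 1 else 0)" "(\<Sum>a\<in>out_arcs G u. ?x a) = 0"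
    if u: "u \<in> verts G" for u
  proof -
    have T: "is_transition G u (C u)" using C u by (simp add: is_circuit_partition_def)
    show "tval (C u) ?x = (if u = v then 1 else 0)" "(\<Sum>a\<in>out_arcs G u. ?x a) = 0"
      by (rule transition_const_pair_sums[OF T u *[OF u]]; assumption)+
  qed
  show ?thesis unfolding vertex_half_def cycle_vector_def
    by (intro conjI ballI segment_vector_arev vals)
qed

text \<open>
  A cycle vector that vanishes at all transitions of \<open>C\<close> is constant along the circuits of \<open>C\<close>, and
  each vertex lies on only one of them, so its four half-edges have the same value.
\<close>

lemma tval_eq_0I:
  assumes C: "is_euler_system G arev C" and y: "cycle_vector y"
    and 0: "\<And>u. u \<in> verts G \<Longrightarrow> tval (C u) y = 0"
    and u: "u \<in> verts G" and T: "is_transition G u T"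
  shows "tval T y = 0"
proof -
  obtain c where c: "covering_trail C c" "u \<in> tail G ` set c"
    by (rule covering_trail_exists[OF C u])
  have f: "follows G arev C c" using c by (simp add: covering_trail_def)
  note fD = followsD[OF f]
  have sym: "y (arev a) = y a" if "a \<in> arcs G" for a using y that by (simp add: cycle_vector_def)
  have nth: "m < length c \<Longrightarrow> y (c ! m) = y (c ! 0)" for m
  proof (induction m)
    case (Suc m)
    let ?v = "tail G (c ! Suc m)"
    have "c ! Suc m \<in> arcs G" "c ! m \<in> arcs G" using fD(2) Suc by auto
    then have vG: "?v \<in> verts G" by simp
    have "{arev (c ! m), c ! Suc m} \<in> C ?v" using fD(4)[of m] Suc by simp
    moreover have "is_transition G ?v (C ?v)"
      using C vG by (simp add: is_euler_system_def is_circuit_partition_def)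
    ultimately have "0 = sum y {arev (c ! m), c ! Suc m}"
      using tval_pair[OF _ vG, of "C ?v" y] y vG 0[OF vG] by (simp add: cycle_vector_def)
    also have "\<dots> = y (c ! m) + y (c ! Suc m)"
      using follows_distinct(2)[OF f, of m "Suc m"] Suc sym[OF \<open>c ! m \<in> arcs G\<close>] by simp
    finally have "y (c ! m) = y (c ! Suc m)" by (metis bit_add_eq_0_iff)
    then show ?case using Suc by simp
  qed simp
  have const: "y a = y (c ! 0)" if a: "a \<in> set c \<union> arev ` set c" for a
  proof -
    obtain b where b: "b \<in> set c" "a = b \<or> a = arev b" using a by blast
    then have "y a = y b" using sym[of b] fD(2) by auto
    moreover obtain m where "m < length c" "b = c ! m" using b(1) by (metis in_set_conv_nth)
    ultimately show ?thesis using nth by simp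
  qed
  have "out_arcs G u \<subseteq> set c \<union> arev ` set c"
    using c unfolding covering_trail_def by blast
  then have *: "y a = y (c ! 0)" if "a \<in> out_arcs G u" for a using const that by blast
  obtain a b d e where abde: "distinct [a, b, d, e]" "T = {{a, b}, {d, e}}"
    "out_arcs G u = {a, b, d, e}" by (rule transition_elems[OF T u])
  have "tval T y = sum y {a, b}"
    by (rule tval_pair[OF T u]) (use abde(2) y u in \<open>auto simp: cycle_vector_def\<close>)
  also have "\<dots> = y a + y b" using abde(1) by simp
  also have "\<dots> = 0" unfolding bit_add_eq_0_iff using *[of a] *[of b] abde(3) by simp
  finally show ?thesis .
qed

text \<open>The values at the transitions of \<open>C\<close> determine the values at all transitions.\<close>

lemma tval_expansion:
  assumes C: "is_euler_system G arev C" and x: "cycle_vector x"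
    and h: "\<And>w. w \<in> verts G \<Longrightarrow> vertex_half C w (h w)"
    and u: "u \<in> verts G" and T: "is_transition G u T"
  shows "tval T x = (\<Sum>w\<in>verts G. tval (C w) x * tval T (h w))"
proof -
  let ?y = "\<lambda>a. x a + (\<Sum>w\<in>verts G. tval (C w) x * h w a)"
  have "cycle_vector ?y"
    by (rule cycle_vector_linear[OF x]) (use h in \<open>simp add: vertex_half_def\<close>)
  moreover have "tval (C v) ?y = 0" if v: "v \<in> verts G" for v
  proof -
    have "(\<Sum>w\<in>verts G. tval (C w) x * tval (C v) (h w)) = (\<Sum>w\<in>verts G. if w = v then tval (C w) x else 0)"
      using h v by (intro sum.cong) (auto simp: vertex_half_def)
    also have "\<dots> = tval (C v) x" using v by (simp add: sum.delta)
    finally show ?thesis unfolding tval_linear by simp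
  qed
  ultimately have "tval T ?y = 0" by (rule tval_eq_0I[OF C _ _ u T])
  then show ?thesis unfolding tval_linear bit_add_eq_0_iff .
qed

lemma vertex_half_tval_unique:
  assumes C: "is_euler_system G arev C" and x: "vertex_half C v x" and y: "vertex_half C v y"
    and u: "u \<in> verts G" and T: "is_transition G u T"
  shows "tval T x = tval T y"
proof -
  let ?z = "\<lambda>a. x a + (\<Sum>w\<in>{v}. 1 * y a)"
  have "cycle_vector ?z"
    by (rule cycle_vector_linear) (use x y in \<open>simp_all add: vertex_half_def\<close>)
  moreover have "tval (C w) ?z = 0" if "w \<in> verts G" for w
    using x y that unfolding tval_linear by (simp add: vertex_half_def)
  ultimately have "tval T ?z = 0" by (rule tval_eq_0I[OF C _ _ u T])
  then have "tval T x + tval T y = 0" unfolding tval_linear by simp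
  then show ?thesis unfolding bit_add_eq_0_iff .
qed

section \<open>Matrix entries as values of vertex halves\<close>

lemma transition_of_pairs:
  assumes T: "is_transition G v T" "v \<in> verts G"
    and ab: "{a, b} \<in> T" and de: "{d, e} \<in> T" and "{a, b} \<noteq> {d, e}"
  shows "distinct [a, b, d, e]" "T = {{a, b}, {d, e}}" "out_arcs G v = {a, b, d, e}"
proof -
  have "card {a, b} = 2" "card {d, e} = 2" using T(1) ab de unfolding is_transition_def by blast+
  then have "a \<noteq> b" "d \<noteq> e" by auto
  moreover have "disjoint T" using T(1) by (simp add: is_transition_def partition_on_def)
  then have "{a, b} \<inter> {d, e} = {}" using ab de assms(5) by (rule disjointD)
  ultimately show "distinct [a, b, d, e]" by auto
  obtain a' b' d' e' where *: "distinct [a', b', d', e']" "T = {{a', b'}, {d', e'}}"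
    "out_arcs G v = {a', b', d', e'}" by (rule transition_elems[OF T])
  have "{a, b} = {a', b'} \<or> {a, b} = {d', e'}" "{d, e} = {a', b'} \<or> {d, e} = {d', e'}"
    using ab de unfolding *(2) by blast+
  then show "T = {{a, b}, {d, e}}" using assms(5)
    unfolding *(2) by (elim disjE) (simp_all only: insert_commute not_True_eq_False)
  then have "\<Union>T = {a, b, d, e}" by auto
  then show "out_arcs G v = {a, b, d, e}" using T(1) by (simp add: is_transition_def partition_on_def)
qed

text \<open>The four half-edges at a vertex in terms of the two passages of the trail through it.\<close>

lemma covering_trail_transition:
  assumes c: "covering_trail C c" and C: "is_circuit_partition G C"
    and j: "j < length c" "l < length c" "j \<noteq> l" "tail G (c ! j) = u" "tail G (c ! l) = u"
  obtains s t where "s < length c" "t < length c" "head G (c ! s) = u" "head G (c ! t) = u"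
    "distinct [arev (c ! s), c ! j, arev (c ! t), c ! l]"
    "C u = {{arev (c ! s), c ! j}, {arev (c ! t), c ! l}}"
    "out_arcs G u = {arev (c ! s), c ! j, arev (c ! t), c ! l}"
proof -
  have f: "follows G arev C c" using c by (simp add: covering_trail_def)
  note fD = followsD[OF f]
  have "c ! j \<in> arcs G" using fD(2) j(1) by auto
  then have u: "u \<in> verts G" using j(4) by auto
  then have T: "is_transition G u (C u)" using C by (simp add: is_circuit_partition_def)
  obtain s where s: "s < length c" "Suc s mod length c = j" by (rule follows_pred[OF f j(1)])
  obtain t where t: "t < length c" "Suc t mod length c = l" by (rule follows_pred[OF f j(2)])
  have "{arev (c ! s), c ! j} \<in> C u" using fD(4)[OF s(1)] unfolding s(2) j(4) .
  moreover have "{arev (c ! t), c ! l} \<in> C u" using fD(4)[OF t(1)] unfolding t(2) j(5) .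
  moreover have "{arev (c ! s), c ! j} \<noteq> {arev (c ! t), c ! l}"
    using follows_distinct(1)[OF f j(1,2)] follows_distinct(2)[OF f t(1) j(1)] j(3)
    by (metis doubleton_eq_iff)
  ultimately have "distinct [arev (c ! s), c ! j, arev (c ! t), c ! l]"
    "C u = {{arev (c ! s), c ! j}, {arev (c ! t), c ! l}}"
    "out_arcs G u = {arev (c ! s), c ! j, arev (c ! t), c ! l}"
    by (rule transition_of_pairs[OF T u])+
  moreover have "head G (c ! s) = u" using fD(3)[OF s(1)] unfolding s(2) j(4) .
  moreover have "head G (c ! t) = u" using fD(3)[OF t(1)] unfolding t(2) j(5) .
  ultimately show thesis using that s(1) t(1) by blast
qed

text \<open>
  At \<open>u \<noteq> v\<close> the segment is constant on each pair of \<open>C u\<close>, and any other transition combines one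
  half-edge from each of these two pairs.
\<close>

lemma tval_segment_other:
  assumes c: "covering_trail C c" and C: "is_circuit_partition G C"
    and i: "i < k" "k < length c" "tail G (c ! i) = v" "tail G (c ! k) = v"
    and j: "j < length c" "l < length c" "j \<noteq> l" "tail G (c ! j) = u" "tail G (c ! l) = u"
    and u: "u \<noteq> v" and T: "is_transition G u T" "T \<noteq> C u"
  shows "tval T (segment_vector c i k) = segment_vector c i k (c ! j) + segment_vector c i k (c ! l)"
proof -
  let ?x = "segment_vector c i k"
  obtain s t where st: "distinct [arev (c ! s), c ! j, arev (c ! t), c ! l]"
    "C u = {{arev (c ! s), c ! j}, {arev (c ! t), c ! l}}"
    "out_arcs G u = {arev (c ! s), c ! j, arev (c ! t), c ! l}"
    by (rule covering_trail_transition[OF c C j])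
  have "c ! j \<in> out_arcs G u" unfolding st(3) by simp
  then have uG: "u \<in> verts G" by auto
  have h: "vertex_half C v ?x" by (rule segment_vertex_half[OF c C i])
  then have sum0: "sum ?x (out_arcs G u) = 0"
    using uG by (simp add: vertex_half_def cycle_vector_def)
  have Cu: "is_transition G u (C u)" using C uG by (simp add: is_circuit_partition_def)
  have "0 = tval (C u) ?x" using h uG u by (simp add: vertex_half_def)
  also have "\<dots> = sum ?x {arev (c ! t), c ! l}"
    by (rule tval_pair[OF Cu uG sum0]) (simp add: st(2))
  also have "\<dots> = ?x (arev (c ! t)) + ?x (c ! l)" using st(1) by simp
  finally have "?x (arev (c ! t)) + ?x (c ! l) = 0" by (rule sym)
  then have eq: "?x (arev (c ! t)) = ?x (c ! l)" unfolding bit_add_eq_0_iff .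
  have "T = {{arev (c ! s), arev (c ! t)}, {c ! j, c ! l}} \<or>
      T = {{arev (c ! s), c ! l}, {c ! j, arev (c ! t)}}"
    by (rule disjE[OF transition_cases[OF T(1) uG st(1,3)]], erule notE[OF T(2)[unfolded st(2)]])
  then show ?thesis
  proof
    assume *: "T = {{arev (c ! s), arev (c ! t)}, {c ! j, c ! l}}"
    have "tval T ?x = sum ?x {c ! j, c ! l}" by (rule tval_pair[OF T(1) uG sum0]) (simp add: *)
    then show ?thesis using st(1) by simp
  next
    assume *: "T = {{arev (c ! s), c ! l}, {c ! j, arev (c ! t)}}"
    have "tval T ?x = sum ?x {c ! j, arev (c ! t)}"
      by (rule tval_pair[OF T(1) uG sum0]) (simp add: *)
    also have "\<dots> = ?x (c ! j) + ?x (arev (c ! t))" using st(1) by simp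
    finally show ?thesis unfolding eq .
  qed
qed

lemma covering_trail_rotate: "covering_trail C c \<Longrightarrow> covering_trail C (rotate k c)"
  by (simp add: covering_trail_def follows_rotate)

lemma is_euler_system_partition: "is_euler_system G arev C \<Longrightarrow> is_circuit_partition G C"
  by (simp add: is_euler_system_def)

lemma covering_trail_from:
  assumes C: "is_euler_system G arev C" and v: "v \<in> verts G"
  obtains c k where "covering_trail C c" "0 < k" "k < length c"
    "\<And>j. j < length c \<Longrightarrow> tail G (c ! j) = v \<longleftrightarrow> j = 0 \<or> j = k"
proof -
  obtain d where d: "covering_trail C d" "v \<in> tail G ` set d"
    by (rule covering_trail_exists[OF C v])
  then obtain a where a: "a \<in> set d" "tail G a = v" by blast
  then obtain m where m: "m < length d" "d ! m = a" by (metis in_set_conv_nth)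
  let ?c = "rotate m d"
  have "0 < length d" using m(1) by linarith
  then have "?c ! 0 = a" using nth_rotate[of 0 d m] m by simp
  have c: "covering_trail C ?c" by (rule covering_trail_rotate[OF d(1)])
  have "v \<in> tail G ` set ?c" using d(2) by simp
  then obtain i k where ik: "i < k" "k < length ?c"
    "\<And>j. j < length ?c \<Longrightarrow> tail G (?c ! j) = v \<longleftrightarrow> j = i \<or> j = k"
    by (rule covering_trail_two_visits[OF c is_euler_system_partition[OF C]]) blast
  have "i = 0" using ik(3)[of 0] ik(1) \<open>?c ! 0 = a\<close> a(2) \<open>0 < length d\<close> by simp
  with ik(1) have "0 < k" by simp
  with c show thesis using ik(2) ik(3)[unfolded \<open>i = 0\<close>] by (rule that)
qed

lemma vertex_half_exists:
  assumes C: "is_euler_system G arev C" and v: "v \<in> verts G"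
  shows "\<exists>x. vertex_half C v x"
proof -
  obtain c k where c: "covering_trail C c" "0 < k" "k < length c"
    "\<And>j. j < length c \<Longrightarrow> tail G (c ! j) = v \<longleftrightarrow> j = 0 \<or> j = k"
    by (rule covering_trail_from[OF C v]) blast
  have "0 < length c" using c(3) by linarith
  then have "tail G (c ! 0) = v" "tail G (c ! k) = v" using c(3,4) by simp_all
  then have "vertex_half C v (segment_vector c 0 k)"
    by (rule segment_vertex_half[OF c(1) is_euler_system_partition[OF C] c(2,3)])
  then show ?thesis by (intro exI[of _ "segment_vector c 0 k"])
qed

lemma covering_trail_in_circuits:
  assumes "covering_trail C c"
  shows "circuit_of arev c \<in> circuits G arev C"
proof -
  have "c \<in> {c. follows G arev C c}" using assms by (simp add: covering_trail_def)
  then show ?thesis unfolding circuits_def by (rule imageI)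
qed

lemma interlaced_iff_tval:
  assumes C: "is_euler_system G arev C" and x: "vertex_half C v x"
    and v: "v \<in> verts G" and u: "u \<in> verts G" "u \<noteq> v" and T: "is_transition G u T" "T \<noteq> C u"
  shows "interlaced G arev C v u \<longleftrightarrow> tval T x = 1"
proof
  note CP = is_euler_system_partition[OF C]
  assume "interlaced G arev C v u"
  then obtain \<gamma> c i j k l where c: "\<gamma> \<in> circuits G arev C" "c \<in> \<gamma>"
    and lt: "i < j" "j < k" "k < l" "l < length c"
    and tl: "tail G (c ! i) = v" "tail G (c ! j) = u" "tail G (c ! k) = v" "tail G (c ! l) = u"
    unfolding interlaced_def by metis
  have ct: "covering_trail C c" by (rule euler_system_circuits[OF C c])
  then have f: "follows G arev C c" by (simp add: covering_trail_def)
  have lt': "i < k" "k < length c" "j < length c" "j \<noteq> l" using lt by simp_all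
  let ?x = "segment_vector c i k"
  have "tval T x = tval T ?x"
    by (rule vertex_half_tval_unique[OF C x segment_vertex_half[OF ct CP lt'(1,2) tl(1,3)] u(1) T(1)])
  also have "\<dots> = ?x (c ! j) + ?x (c ! l)"
    by (rule tval_segment_other[OF ct CP lt'(1,2) tl(1,3) lt'(3) lt(4) lt'(4) tl(2,4) u(2) T])
  also have "\<dots> = 1"
    unfolding segment_vector_nth[OF f lt'(2,3)] segment_vector_nth[OF f lt'(2) lt(4)]
    using lt by simp
  finally show "tval T x = 1" .
next
  note CP = is_euler_system_partition[OF C]
  assume 1: "tval T x = 1"
  \<comment> \<open>With the trail starting at \<open>v\<close>, the order \<open>u \<dots> v \<dots> u \<dots> v\<close> is excluded.\<close>
  obtain c k where c: "covering_trail C c" "0 < k" "k < length c"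
    "\<And>j. j < length c \<Longrightarrow> tail G (c ! j) = v \<longleftrightarrow> j = 0 \<or> j = k"
    by (rule covering_trail_from[OF C v]) blast
  have f: "follows G arev C c" using c(1) by (simp add: covering_trail_def)
  have "0 < length c" using c(3) by linarith
  then have tl: "tail G (c ! 0) = v" "tail G (c ! k) = v" using c(3,4) by simp_all
  let ?x = "segment_vector c 0 k"
  have "tval T x = tval T ?x"
    by (rule vertex_half_tval_unique[OF C x segment_vertex_half[OF c(1) CP c(2,3) tl] u(1) T(1)])
  then have 1: "tval T ?x = 1" using 1 by simp
  have "u \<in> tail G ` set c"
  proof (rule ccontr)
    assume out: "u \<notin> tail G ` set c"
    have "sum ?x p = 0" if "p \<in> T" for p
    proof (rule sum.neutral, rule ballI)
      fix a assume "a \<in> p"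
      then have "a \<in> out_arcs G u" using T(1) that unfolding is_transition_def partition_on_def by blast
      then show "?x a = 0" by (rule segment_vector_outside[OF f c(3) out])
    qed
    then have "tval T ?x = 0" by (rule transition_const_pair_sums(1)[OF T(1) u(1)])
    then show False using 1 by simp
  qed
  then obtain j l where jl: "j < l" "l < length c"
    "\<And>m. m < length c \<Longrightarrow> tail G (c ! m) = u \<longleftrightarrow> m = j \<or> m = l"
    by (rule covering_trail_two_visits[OF c(1) CP]) blast
  have j: "j < length c" "j \<noteq> l" using jl(1,2) by simp_all
  then have tu: "tail G (c ! j) = u" "tail G (c ! l) = u" using jl(2,3) by simp_all
  have "tval T ?x = ?x (c ! j) + ?x (c ! l)"
    by (rule tval_segment_other[OF c(1) CP c(2,3) tl j(1) jl(2) j(2) tu u(2) T])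
  then have "?x (c ! j) \<noteq> ?x (c ! l)" using 1 bit_add_eq_0_iff by (metis zero_neq_one)
  then have "j < k \<and> k \<le> l"
    unfolding segment_vector_nth[OF f c(3) j(1)] segment_vector_nth[OF f c(3) jl(2)]
    using jl(1) by (auto split: if_splits)
  moreover have "j \<noteq> 0" "l \<noteq> k" using tl tu u(2) by metis+
  ultimately have "0 < j \<and> j < k \<and> k < l \<and> l < length c" using jl(2) by simp
  then show "interlaced G arev C v u"
    unfolding interlaced_def using u(2) tl tu covering_trail_in_circuits[OF c(1)] circuit_of_self
    by metis
qed

text \<open>
  Between its visits \<open>i < k\<close> of \<open>v\<close> the segment contains the half-edge by which the trail leaves at
  \<open>i\<close> and the one by which it arrives at \<open>k\<close>; only \<open>\<chi>\<close> puts these two into one pair.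
\<close>

lemma label_psi_iff_tval:
  assumes C: "is_euler_system G arev C" and x: "vertex_half C v x"
    and v: "v \<in> verts G" and T: "is_transition G v T"
  shows "label_psi G arev C v T \<longleftrightarrow> T \<noteq> C v \<and> tval T x = 1"
proof -
  note CP = is_euler_system_partition[OF C]
  have main: "T = {in_half_edges G arev c v, out_half_edges G c v} \<longleftrightarrow> T \<noteq> C v \<and> tval T x = 1"
    if c: "covering_trail C c" and vc: "v \<in> tail G ` set c" for c
  proof -
    have f: "follows G arev C c" using c by (simp add: covering_trail_def)
    note fD = followsD[OF f]
    obtain i k where ik: "i < k" "k < length c"
      "\<And>j. j < length c \<Longrightarrow> tail G (c ! j) = v \<longleftrightarrow> j = i \<or> j = k"
      by (rule covering_trail_two_visits[OF c CP vc]) blast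
    have i: "i < length c" "i \<noteq> k" using ik(1,2) by simp_all
    then have tl: "tail G (c ! i) = v" "tail G (c ! k) = v" using ik(2,3) by simp_all
    obtain s t where st: "s < length c" "t < length c" "head G (c ! s) = v" "head G (c ! t) = v"
      "distinct [arev (c ! s), c ! i, arev (c ! t), c ! k]"
      "C v = {{arev (c ! s), c ! i}, {arev (c ! t), c ! k}}"
      "out_arcs G v = {arev (c ! s), c ! i, arev (c ! t), c ! k}"
      by (rule covering_trail_transition[OF c CP i(1) ik(2) i(2) tl])
    have in_set: "c ! i \<in> set c" "c ! k \<in> set c" "c ! s \<in> set c" "c ! t \<in> set c"
      using i(1) ik(2) st(1,2) by simp_all
    have out: "out_half_edges G c v = {c ! i, c ! k}"
    proof
      show "out_half_edges G c v \<subseteq> {c ! i, c ! k}"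
      proof
        fix a assume "a \<in> out_half_edges G c v"
        then have "a \<in> set c" "tail G a = v" by (simp_all add: out_half_edges_def)
        then obtain m where "m < length c" "c ! m = a" "tail G (c ! m) = v"
          by (metis in_set_conv_nth)
        then show "a \<in> {c ! i, c ! k}" using ik(3) by blast
      qed
      show "{c ! i, c ! k} \<subseteq> out_half_edges G c v"
        using in_set tl by (simp add: out_half_edges_def)
    qed
    have inn: "in_half_edges G arev c v = {arev (c ! s), arev (c ! t)}"
    proof
      show "in_half_edges G arev c v \<subseteq> {arev (c ! s), arev (c ! t)}"
      proof
        fix a assume "a \<in> in_half_edges G arev c v"
        then obtain b where b: "b \<in> set c" "head G b = v" "a = arev b"
          unfolding in_half_edges_def by blast
        then obtain m where m: "m < length c" "c ! m = b" by (metis in_set_conv_nth)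
        have "b \<in> arcs G" using b(1) fD(2) by blast
        then have "a \<in> out_arcs G v" using b(2,3) by simp
        moreover have "a \<noteq> c ! i" "a \<noteq> c ! k"
          using follows_distinct(2)[OF f m(1) i(1)] follows_distinct(2)[OF f m(1) ik(2)] m(2) b(3)
          by simp_all
        ultimately show "a \<in> {arev (c ! s), arev (c ! t)}" unfolding st(7) by blast
      qed
      show "{arev (c ! s), arev (c ! t)} \<subseteq> in_half_edges G arev c v"
        using in_set st(3,4) by (simp add: in_half_edges_def)
    qed
    let ?x = "segment_vector c i k"
    have h: "vertex_half C v ?x" by (rule segment_vertex_half[OF c CP ik(1,2) tl])
    have xT: "tval T x = tval T ?x" by (rule vertex_half_tval_unique[OF C x h v T])
    have sum0: "sum ?x (out_arcs G v) = 0" using h v by (simp add: vertex_half_def cycle_vector_def)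
    have CT: "is_transition G v (C v)" using CP v by (simp add: is_circuit_partition_def)
    have xi: "?x (c ! i) = 1" and xk: "?x (c ! k) = 0"
      unfolding segment_vector_nth[OF f ik(2) i(1)] segment_vector_nth[OF f ik(2) ik(2)]
      using ik(1) by simp_all
    have "1 = tval (C v) ?x" using h v by (simp add: vertex_half_def)
    also have "\<dots> = sum ?x {arev (c ! t), c ! k}"
      by (rule tval_pair[OF CT v sum0]) (simp add: st(6))
    also have "\<dots> = ?x (arev (c ! t))" using st(5) xk by simp
    finally have xt: "?x (arev (c ! t)) = 1" by simp
    show ?thesis unfolding out inn
    proof
      assume *: "T = {{arev (c ! s), arev (c ! t)}, {c ! i, c ! k}}"
      have "T \<noteq> C v"
      proof
        assume "T = C v"
        then have "{c ! i, c ! k} \<in> C v" using * by blast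
        then show False using st(5) unfolding st(6) by (auto simp: doubleton_eq_iff)
      qed
      moreover have "tval T ?x = sum ?x {c ! i, c ! k}"
        by (rule tval_pair[OF T v sum0]) (simp add: *)
      ultimately show "T \<noteq> C v \<and> tval T x = 1" using st(5) xi xk xT by simp
    next
      assume a: "T \<noteq> C v \<and> tval T x = 1"
      have not_chi: "T \<noteq> {{arev (c ! s), c ! k}, {c ! i, arev (c ! t)}}"
      proof
        assume *: "T = {{arev (c ! s), c ! k}, {c ! i, arev (c ! t)}}"
        have "tval T ?x = sum ?x {c ! i, arev (c ! t)}"
          by (rule tval_pair[OF T v sum0]) (simp add: *)
        then show False using st(5) xi xt xT a by simp
      qed
      have not_phi: "T \<noteq> {{arev (c ! s), c ! i}, {arev (c ! t), c ! k}}"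
        using a unfolding st(6) by (rule conjunct1)
      show "T = {{arev (c ! s), arev (c ! t)}, {c ! i, c ! k}}"
        by (rule disjE[OF transition_cases[OF T v st(5,7)]], erule notE[OF not_phi],
            erule disjE, assumption, erule notE[OF not_chi])
    qed
  qed
  show ?thesis
  proof
    assume "label_psi G arev C v T"
    then obtain \<gamma> c where c: "\<gamma> \<in> circuits G arev C" "c \<in> \<gamma>" "v \<in> tail G ` set c"
      "T = {in_half_edges G arev c v, out_half_edges G c v}" unfolding label_psi_def by metis
    show "T \<noteq> C v \<and> tval T x = 1"
      using main[OF euler_system_circuits[OF C c(1,2)] c(3)] c(4) by (rule iffD1)
  next
    assume a: "T \<noteq> C v \<and> tval T x = 1"
    obtain c where c: "covering_trail C c" "v \<in> tail G ` set c"
      by (rule covering_trail_exists[OF C v])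
    have "T = {in_half_edges G arev c v, out_half_edges G c v}"
      using main[OF c] a by (rule iffD2)
    then show "label_psi G arev C v T"
      unfolding label_psi_def using covering_trail_in_circuits[OF c(1)] circuit_of_self c(2) by blast
  qed
qed

text \<open>
  Column \<open>u\<close> needs no exception when \<open>P u = C u\<close>, since \<open>tval (C u) x\<close> is then the entry of the
  identity matrix.
\<close>

lemma relative_interlacement_eq_tval:
  assumes C: "is_euler_system G arev C" and P: "is_circuit_partition G P"
    and x: "vertex_half C v x" and v: "v \<in> verts G" and u: "u \<in> verts G"
  shows "relative_interlacement G arev P C v u =
    (if u = v \<or> P v \<noteq> C v then tval (P u) x else 0)"
proof -
  have T: "is_transition G u (P u)" using P u by (simp add: is_circuit_partition_def)
  have Cu: "tval (C u) x = (if u = v then 1 else 0)" using x u by (simp add: vertex_half_def)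
  have bit: "b = (if b = 1 then 1 else 0)" for b :: bit by simp
  show ?thesis
  proof (cases "u = v")
    case True
    then have "label_psi G arev C v (P v) \<longleftrightarrow> P v \<noteq> C v \<and> tval (P v) x = 1"
      using label_psi_iff_tval[OF C x v] T by simp
    then show ?thesis
      using True Cu bit[of "tval (P v) x"] unfolding relative_interlacement_def label_phi_def by auto
  next
    case False
    show ?thesis
    proof (cases "P u = C u")
      case True
      then show ?thesis using False Cu unfolding relative_interlacement_def label_phi_def by simp
    next
      case PC: False
      have "interlaced G arev C v u \<longleftrightarrow> tval (P u) x = 1"
        by (rule interlaced_iff_tval[OF C x v u False T PC])
      then show ?thesis
        using False PC bit[of "tval (P u) x"]
        unfolding relative_interlacement_def interlacement_def label_phi_def by auto
    qed
  qed
qed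

end

section \<open>The product formula\<close>

theorem corollary20:
  fixes F :: "('v, 'e) pre_digraph" and arev :: "'e \<Rightarrow> 'e"
    and C C' P :: "('v, 'e) circuit_partition"
  assumes "four_regular_multigraph F arev"
    and "is_euler_system F arev C"
    and "is_euler_system F arev C'"
    and "is_circuit_partition F P"
    and "\<And>v. v \<in> verts F \<Longrightarrow> C v = C' v \<Longrightarrow> P v = C v"
    and "\<And>v. v \<in> verts F \<Longrightarrow> C v \<noteq> C' v \<Longrightarrow> P v \<noteq> C v \<and> P v \<noteq> C' v"
  shows "\<forall>v\<in>verts F. \<forall>w\<in>verts F.
    relative_interlacement F arev P C v w =
      (\<Sum>u\<in>verts F. relative_interlacement F arev C' C v u * relative_interlacement F arev P C' u w)"
proof (intro ballI)
  fix v w assume v: "v \<in> verts F" and w: "w \<in> verts F"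
  interpret four_regular_multigraph F arev by fact
  note C = assms(2) and C' = assms(3) and P = assms(4)
  note same = assms(5) and third = assms(6)
  have C'P: "is_circuit_partition F C'" by (rule is_euler_system_partition[OF C'])
  obtain x where x: "vertex_half C v x" using vertex_half_exists[OF C v] by blast
  obtain h where h: "\<And>u. u \<in> verts F \<Longrightarrow> vertex_half C' u (h u)"
    using vertex_half_exists[OF C'] by metis
  have Cx: "tval (C u) x = (if u = v then 1 else 0)" if "u \<in> verts F" for u
    using x that by (simp add: vertex_half_def)
  let ?R = "\<lambda>u. relative_interlacement F arev C' C v u * relative_interlacement F arev P C' u w"
  have R: "?R u = (if u = v \<or> C' v \<noteq> C v then tval (C' u) x else 0) *
      (if w = u \<or> P u \<noteq> C' u then tval (P w) (h u) else 0)" if u: "u \<in> verts F" for u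
    unfolding relative_interlacement_eq_tval[OF C C'P x v u]
      relative_interlacement_eq_tval[OF C' P h[OF u] u w] ..
  have lhs: "relative_interlacement F arev P C v w =
      (if w = v \<or> P v \<noteq> C v then tval (P w) x else 0)"
    by (rule relative_interlacement_eq_tval[OF C P x v w])
  have T: "is_transition F w (P w)" using P w by (simp add: is_circuit_partition_def)
  show "relative_interlacement F arev P C v w = (\<Sum>u\<in>verts F. ?R u)"
  proof (cases "C v = C' v")
    case True
    \<comment> \<open>Row \<open>v\<close> is the unit row in all three matrices.\<close>
    have "?R u = (if u = v then if w = v then 1 else 0 else 0)" if u: "u \<in> verts F" for u
    proof (cases "u = v")
      case uv: True
      have "tval (P v) (h v) = 1" using h[OF v] v same[OF v True] True by (simp add: vertex_half_def)
      then show ?thesis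
        unfolding R[OF u] using uv Cx[OF v] True same[OF v True] by simp
    next
      case False
      then show ?thesis unfolding R[OF u] using True by simp
    qed
    then have "(\<Sum>u\<in>verts F. ?R u) = (\<Sum>u\<in>verts F. if u = v then if w = v then 1 else 0 else 0)"
      by (rule sum.cong[OF refl])
    also have "\<dots> = (if w = v then 1 else 0)" using v by simp
    also have "\<dots> = relative_interlacement F arev P C v w"
      unfolding lhs using same[OF v True] Cx[OF v] by simp
    finally show ?thesis by simp
  next
    case False
    \<comment> \<open>Where row \<open>u\<close> of the second factor is cleared, \<open>C u = C' u\<close>, and then the entry
      of the first factor is \<open>0\<close> because \<open>u \<noteq> v\<close>.\<close>
    have "?R u = tval (C' u) x * tval (P w) (h u)" if u: "u \<in> verts F" for u
    proof (cases "P u = C' u")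
      case True
      then have CC: "C u = C' u" using third[OF u] by blast
      then have "u \<noteq> v" using False by blast
      then have "tval (C' u) x = 0" using Cx[OF u] CC by simp
      then show ?thesis unfolding R[OF u] by simp
    next
      case PC: False
      then show ?thesis unfolding R[OF u] using False by simp
    qed
    then have "(\<Sum>u\<in>verts F. ?R u) = (\<Sum>u\<in>verts F. tval (C' u) x * tval (P w) (h u))"
      by (rule sum.cong[OF refl])
    also have "\<dots> = tval (P w) x"
      by (rule tval_expansion[OF C' _ h w T, symmetric]) (use x in \<open>simp add: vertex_half_def\<close>)
    also have "\<dots> = relative_interlacement F arev P C v w"
      unfolding lhs using third[OF v False] by simp
    finally show ?thesis by simp
  qed
qed

end
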